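(* Let $D$ be a strongly connected oriented graph (finite digraph with no loops and no pair of symmetric arcs) of girth $4$ with $|V(D)|\ge 6$. If $D$ is not isomorphic to a member of any of the families $H_1,H_2,\dots,H_7$ (defined in the context), then $D$ is $\lambda'$-connected and $$\lambda(D)\le \lambda'(D)\le \xi(D).$$
   Context: All digraphs are finite oriented graphs. $u\rightarrow v$ means $(u,v)$ is an arc; $u,v$ are adjacent if $u\rightarrow v$ or $v\rightarrow u$. $d^+(v)$, $d^-(v)$ denote out- and in-degree. The girth $g(D)$ is the length of a shortest directed cycle. A digraph is strong if there is a directed path between every ordered pair of vertices; a strong component is a maximal induced strong subdigraph. $\lambda(D)$ (arc-connectivity) is the largest $k$ such that deleting any at most $k-1$ arcs leaves a strong digraph. Restricted arc-connectivity: for a strong digraph $D$, an arc set $S$ is a restricted arc-cut if $D-S$ has a non-trivial strong component $D_1$ (more than one vertex) such that $D-V(D_1)$ contains an arc. $\lambda'(D)$ is the minimum cardinality of a restricted arc-cut; $D$ is $\lambda'$-connected if a restricted arc-cut exists. For a digraph $D$ of girth $g$ and a $g$-cycle $C=(v_1,\dots,v_g)$, $\xi(C)=\min\{\sum_{i=1}^g d^+(v_i)-g,\ \sum_{i=1}^g d^-(v_i)-g\}$, and $\xi(D)=\min\{\xi(C): C \text{ a } g\text{-cycle of } D\}$. Families (each member is the digraph consisting exactly of the listed vertices and arcs; vertex sets $A,B,C,D'$ below consist of new distinct vertices and may be empty unless stated otherwise): $H_1$: the $4$-cycle $(u,v,w,z,u)$ together with sets $A=\{a_1,\dots,a_p\}$,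 $B=\{b_1,\dots,b_q\}$, $C=\{c_1,\dots,c_r\}$, $D'=\{d_1,\dots,d_s\}$ with $u\rightarrow a_i\rightarrow v$, $v\rightarrow b_i\rightarrow w$, $w\rightarrow c_i\rightarrow z$, $z\rightarrow d_i\rightarrow u$ for all indices. $H_2$: the $4$-cycles $(u,v,w,z,u)$ and $(u,v,w,x,u)$, with sets $A=\{a_1,\dots,a_p\}$, $B=\{b_1,\dots,b_q\}$ such that $w\rightarrow a_i\rightarrow u$ and $u\rightarrow b_i\rightarrow w$. $H_3$: the $4$-cycles $(u,v,w,z,u)$ and $(u,v,w,x,u)$, with sets $A,B,C$ such that $u\rightarrow a_i\rightarrow v$, $v\rightarrow b_i\rightarrow w$, $w\rightarrow c_i\rightarrow u$. $H_4$: the $4$-cycles $(u,v,w,z,u)$ and $(u,v,w,x,u)$, a vertex $y$ with $u\rightarrow y\rightarrow w$ and $y$ adjacent to $v$, and a set $A$ with $w\rightarrow a_i\rightarrow u$. $H_5$: the $4$-cycles $(u,v,w,z,u)$ and $(u,v,w,x,u)$ with $x$ adjacent to $z$, and a set $A$ with $u\rightarrow a_i\rightarrow w$. $H_6$: the $4$-cycles $(u,v,w,z,u)$ and $(u,v,w,x,u)$ with $x$ adjacent to $z$, and sets $A,B$ with $u\rightarrow a_i\rightarrow v$ and $v\rightarrow b_i\rightarrow w$. $H_7$: the $4$-cycles $(u,v,w,z,u)$ and $(u,v,w,x,u)$ with $x$ adjacent to $z$, and a vertex $y$ adjacent to $v$ with $u\rightarrow y\rightarrow w$. *)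

theory Defs
  imports Graph_Theory.Graph_Theory "HOL-Library.Extended_Nat"
begin

locale oriented_graph = pair_digraph +
  assumes no_symmetric_arcs: "(u, v) \<in> parcs G \<Longrightarrow> (v, u) \<notin> parcs G"

definition del_arcs :: "'a pair_pre_digraph \<Rightarrow> ('a \<times> 'a) set \<Rightarrow> 'a pair_pre_digraph" where
  "del_arcs D S = \<lparr>pverts = pverts D, parcs = parcs D - S\<rparr>"

(* For a digraph without directed cycles this is the infimum of the empty set, i.e. infinity. *)
definition girth :: "'a pair_pre_digraph \<Rightarrow> enat" where
  "girth D = (INF p \<in> {p. pre_digraph.cycle (with_proj D) p}. enat (length p))"

(* "card S < k" is "at most k - 1 arcs", also for k = 0. The maximum exists as soon as D is
   finite and has two vertices, because deleting all arcs then destroys strong connectivity. *)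
definition arc_connectivity :: "'a pair_pre_digraph \<Rightarrow> nat" where
  "arc_connectivity D =
     (GREATEST k. \<forall>S \<subseteq> parcs D. card S < k \<longrightarrow> strongly_connected (with_proj (del_arcs D S)))"

(* The arc outside of D1 is required in D itself, not in D - S. *)
definition restricted_arc_cut :: "'a pair_pre_digraph \<Rightarrow> ('a \<times> 'a) set \<Rightarrow> bool" where
  "restricted_arc_cut D S \<longleftrightarrow> S \<subseteq> parcs D \<and>
     (\<exists>D1 \<in> pre_digraph.sccs (with_proj (del_arcs D S)).
        card (verts D1) > 1 \<and> arcs (with_proj D \<restriction> (pverts D - verts D1)) \<noteq> {})"

definition restricted_arc_connected :: "'a pair_pre_digraph \<Rightarrow> bool" where
  "restricted_arc_connected D \<longleftrightarrow> (\<exists>S. restricted_arc_cut D S)"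

(* The infimum of a nonempty set of natural numbers is its minimum. *)
definition restricted_arc_connectivity :: "'a pair_pre_digraph \<Rightarrow> nat" where
  "restricted_arc_connectivity D = (INF S \<in> {S. restricted_arc_cut D S}. card S)"

definition girth_cycle :: "'a pair_pre_digraph \<Rightarrow> ('a \<times> 'a) list \<Rightarrow> bool" where
  "girth_cycle D p \<longleftrightarrow> pre_digraph.cycle (with_proj D) p \<and> enat (length p) = girth D"

(* A cycle is the list of its arcs, so the tails of its arcs run once through its vertices.
   In a finite digraph each of these has positive out- and in-degree, hence neither
   subtraction truncates. *)
definition xi_cycle :: "'a pair_pre_digraph \<Rightarrow> ('a \<times> 'a) list \<Rightarrow> nat" where
  "xi_cycle D p =
     min ((\<Sum>e\<leftarrow>p. out_degree (with_proj D) (fst e)) - length p)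
         ((\<Sum>e\<leftarrow>p. in_degree (with_proj D) (fst e)) - length p)"

definition xi :: "'a pair_pre_digraph \<Rightarrow> nat" where
  "xi D = (INF p \<in> {p. girth_cycle D p}. xi_cycle D p)"

fun new_vertex_sets :: "'a set \<Rightarrow> 'a set list \<Rightarrow> bool" where
  "new_vertex_sets V [] \<longleftrightarrow> True"
| "new_vertex_sets V (A # As) \<longleftrightarrow> finite A \<and> A \<inter> V = {} \<and> new_vertex_sets (V \<union> A) As"

(* The arcs making u -> a -> v hold for all a in A. *)
definition via :: "'a \<Rightarrow> 'a set \<Rightarrow> 'a \<Rightarrow> ('a \<times> 'a) set" where
  "via u A v = {u} \<times> A \<union> A \<times> {v}"

abbreviation cycle_arcs :: "'a list \<Rightarrow> ('a \<times> 'a) set" where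
  "cycle_arcs vs \<equiv> set (vwalk_arcs vs)"

(* In the families, "x and z are adjacent" is expressed by an arc e (or f) that is one of
   (x, z) and (z, x): both orientations occur, but only one of them within a member. *)

definition family_H1 :: "'a pair_pre_digraph set" where
  "family_H1 =
     {\<lparr>pverts = {u, v, w, z} \<union> A \<union> B \<union> C \<union> E,
       parcs = cycle_arcs [u, v, w, z, u] \<union> via u A v \<union> via v B w \<union> via w C z \<union> via z E u\<rparr>
      | u v w z A B C E.
        distinct [u, v, w, z] \<and> new_vertex_sets {u, v, w, z} [A, B, C, E]}"

definition family_H2 :: "'a pair_pre_digraph set" where
  "family_H2 =
     {\<lparr>pverts = {u, v, w, z, x} \<union> A \<union> B,
       parcs = cycle_arcs [u, v, w, z, u] \<union> cycle_arcs [u, v, w, x, u]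
         \<union> via w A u \<union> via u B w\<rparr>
      | u v w z x A B.
        distinct [u, v, w, z, x] \<and> new_vertex_sets {u, v, w, z, x} [A, B]}"

definition family_H3 :: "'a pair_pre_digraph set" where
  "family_H3 =
     {\<lparr>pverts = {u, v, w, z, x} \<union> A \<union> B \<union> C,
       parcs = cycle_arcs [u, v, w, z, u] \<union> cycle_arcs [u, v, w, x, u]
         \<union> via u A v \<union> via v B w \<union> via w C u\<rparr>
      | u v w z x A B C.
        distinct [u, v, w, z, x] \<and> new_vertex_sets {u, v, w, z, x} [A, B, C]}"

definition family_H4 :: "'a pair_pre_digraph set" where
  "family_H4 =
     {\<lparr>pverts = {u, v, w, z, x, y} \<union> A,
       parcs = cycle_arcs [u, v, w, z, u] \<union> cycle_arcs [u, v, w, x, u]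
         \<union> {(u, y), (y, w), e} \<union> via w A u\<rparr>
      | u v w z x y e A.
        distinct [u, v, w, z, x, y] \<and> e \<in> {(y, v), (v, y)} \<and>
        new_vertex_sets {u, v, w, z, x, y} [A]}"

definition family_H5 :: "'a pair_pre_digraph set" where
  "family_H5 =
     {\<lparr>pverts = {u, v, w, z, x} \<union> A,
       parcs = cycle_arcs [u, v, w, z, u] \<union> cycle_arcs [u, v, w, x, u] \<union> {e} \<union> via u A w\<rparr>
      | u v w z x e A.
        distinct [u, v, w, z, x] \<and> e \<in> {(x, z), (z, x)} \<and>
        new_vertex_sets {u, v, w, z, x} [A]}"

definition family_H6 :: "'a pair_pre_digraph set" where
  "family_H6 =
     {\<lparr>pverts = {u, v, w, z, x} \<union> A \<union> B,
       parcs = cycle_arcs [u, v, w, z, u] \<union> cycle_arcs [u, v, w, x, u] \<union> {e}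
         \<union> via u A v \<union> via v B w\<rparr>
      | u v w z x e A B.
        distinct [u, v, w, z, x] \<and> e \<in> {(x, z), (z, x)} \<and>
        new_vertex_sets {u, v, w, z, x} [A, B]}"

definition family_H7 :: "'a pair_pre_digraph set" where
  "family_H7 =
     {\<lparr>pverts = {u, v, w, z, x, y},
       parcs = cycle_arcs [u, v, w, z, u] \<union> cycle_arcs [u, v, w, x, u]
         \<union> {e, f} \<union> {(u, y), (y, w)}\<rparr>
      | u v w z x y e f.
        distinct [u, v, w, z, x, y] \<and> e \<in> {(x, z), (z, x)} \<and> f \<in> {(y, v), (v, y)}}"

definition exceptional_digraphs :: "'a pair_pre_digraph set" where
  "exceptional_digraphs =
     family_H1 \<union> family_H2 \<union> family_H3 \<union> family_H4 \<union> family_H5 \<union> family_H6 \<union> family_H7"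

end

theory Submission
  imports Defs
begin

text \<open>The arcs leaving (or entering) a 4-cycle \<open>C\<close> that attains the minimum form a restricted arc-cut
  of size \<open>\<xi>(D)\<close> as soon as some arc avoids \<open>C\<close>. Otherwise the vertices outside \<open>C = (a, b, c, d)\<close> are
  independent. If \<open>a \<rightarrow> y \<rightarrow> c\<close> with \<open>y\<close> outside \<open>C\<close> and \<open>b\<close> has a further neighbour \<open>z \<noteq> y\<close> outside \<open>C\<close>,
  then the arc between \<open>b\<close> and \<open>z\<close> avoids the 4-cycle \<open>(a, y, c, d)\<close>, which has a cut that is no
  larger. If this exchange is impossible at every vertex of \<open>C\<close>, girth 4 leaves so few ways of
  attaching an outside vertex to \<open>C\<close> that \<open>D\<close> is a member of one of the families.\<close>

section \<open>4-cycles in relations without short cycles\<close>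

definition four_cycle :: "'a rel \<Rightarrow> 'a \<Rightarrow> 'a \<Rightarrow> 'a \<Rightarrow> 'a \<Rightarrow> bool" where
  "four_cycle E a b c d \<longleftrightarrow> {(a, b), (b, c), (c, d), (d, a)} \<subseteq> E"

text \<open>For a finite relation this is girth at least 4, spelled out arc by arc;
  \<open>x = y\<close> in the second clause excludes loops.\<close>

definition no_short_cycles :: "'a rel \<Rightarrow> bool" where
  "no_short_cycles E \<longleftrightarrow> finite E \<and> (\<forall>x y. (x, y) \<in> E \<longrightarrow> (y, x) \<notin> E) \<and>
     (\<forall>x y z. (x, y) \<in> E \<longrightarrow> (y, z) \<in> E \<longrightarrow> (z, x) \<notin> E)"

text \<open>Applied to the converse relation this becomes the in-degree sum, so an argument about
  out-degrees serves both terms of the minimum in \<open>xi\<close>.\<close>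

definition out_sum :: "'a rel \<Rightarrow> 'a \<Rightarrow> 'a \<Rightarrow> 'a \<Rightarrow> 'a \<Rightarrow> nat" where
  "out_sum E a b c d = card (E `` {a}) + card (E `` {b}) + card (E `` {c}) + card (E `` {d})"

definition outer_arc :: "'a rel \<Rightarrow> 'a set \<Rightarrow> bool" where
  "outer_arc E C \<longleftrightarrow> (\<exists>x y. (x, y) \<in> E \<and> x \<notin> C \<and> y \<notin> C)"

text \<open>A vertex mutually reachable in \<open>E - S\<close> with the cycle lies in both \<open>P\<close> and \<open>Q\<close>,
  so the cycle is a strong component. The condition is invariant under reversing all arcs.\<close>

definition four_cycle_cut :: "'a rel \<Rightarrow> 'a rel \<Rightarrow> bool" where
  "four_cycle_cut E S \<longleftrightarrow> S \<subseteq> E \<and> (\<exists>a b c d P Q.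
     four_cycle (E - S) a b c d \<and> {a, b, c, d} = P \<inter> Q \<and>
     (E - S) `` P \<subseteq> P \<and> (E - S)\<inverse> `` Q \<subseteq> Q \<and> outer_arc E {a, b, c, d})"

text \<open>On a 4-cycle without short cycles around it, \<open>y \<noteq> b\<close> already forces
  \<open>y\<close> off the cycle: a loop or a 2-cycle would arise otherwise.\<close>

definition exchange :: "'a rel \<Rightarrow> 'a \<Rightarrow> 'a \<Rightarrow> 'a \<Rightarrow> 'a \<Rightarrow> bool" where
  "exchange E a b c d \<longleftrightarrow> (\<exists>y z. (a, y) \<in> E \<and> (y, c) \<in> E \<and> y \<noteq> b \<and>
     z \<notin> {a, b, c, d, y} \<and> ((b, z) \<in> E \<or> (z, b) \<in> E))"

lemma no_short_cyclesD:
  assumes "no_short_cycles E"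
  shows "finite E" "(x, y) \<in> E \<Longrightarrow> (y, x) \<notin> E" "(x, y) \<in> E \<Longrightarrow> x \<noteq> y"
    "(x, y) \<in> E \<Longrightarrow> (y, z) \<in> E \<Longrightarrow> (z, x) \<notin> E"
  using assms unfolding no_short_cycles_def by blast+

lemma no_short_cycles_converse [simp]: "no_short_cycles (E\<inverse>) \<longleftrightarrow> no_short_cycles (E :: 'a rel)"
proof -
  have "no_short_cycles (R\<inverse>)" if "no_short_cycles R" for R :: "'a rel"
    unfolding no_short_cycles_def
  proof (intro conjI allI impI)
    show "finite (R\<inverse>)" using no_short_cyclesD(1)[OF that] by simp
  next
    fix x y assume "(x, y) \<in> R\<inverse>"
    then show "(y, x) \<notin> R\<inverse>" using no_short_cyclesD(2)[OF that] by simp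
  next
    fix x y z assume "(x, y) \<in> R\<inverse>" "(y, z) \<in> R\<inverse>"
    then show "(z, x) \<notin> R\<inverse>" using no_short_cyclesD(4)[OF that, of z y x] by simp
  qed
  from this[of E] this[of "E\<inverse>"] show ?thesis by auto
qed

lemma outer_arc_converse [simp]: "outer_arc (E\<inverse>) C \<longleftrightarrow> outer_arc E C"
  unfolding outer_arc_def by auto

lemma exchange_converse: "exchange (E\<inverse>) c b a d \<longleftrightarrow> exchange E a b c d"
  unfolding exchange_def by auto

lemma four_cycle_converse: "four_cycle (E\<inverse>) c b a d \<longleftrightarrow> four_cycle E a b c d"
  unfolding four_cycle_def by auto

text \<open>Reversal interchanges \<open>P\<close> and \<open>Q\<close>, and the cycle is read
  backwards as \<open>c b a d\<close>.\<close>

lemma four_cycle_cut_converse: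
  assumes "four_cycle_cut (E\<inverse>) S"
  shows "four_cycle_cut E (S\<inverse>)"
proof -
  obtain a b c d P Q where h: "S \<subseteq> E\<inverse>" "four_cycle (E\<inverse> - S) a b c d"
    "{a, b, c, d} = P \<inter> Q" "(E\<inverse> - S) `` P \<subseteq> P" "(E\<inverse> - S)\<inverse> `` Q \<subseteq> Q"
    "outer_arc E {a, b, c, d}"
    using assms unfolding four_cycle_cut_def by auto
  have eq: "E\<inverse> - S = (E - S\<inverse>)\<inverse>" by auto
  have "{c, b, a, d} = {a, b, c, d}" by auto
  then have "four_cycle (E - S\<inverse>) c b a d \<and> {c, b, a, d} = Q \<inter> P \<and> (E - S\<inverse>) `` Q \<subseteq> Q \<and>
      (E - S\<inverse>)\<inverse> `` P \<subseteq> P \<and> outer_arc E {c, b, a, d}"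
    using h four_cycle_converse[where E = "E - S\<inverse>" and a = c and b = b and c = a and d = d] unfolding eq
    by (simp add: Int_commute)
  moreover have "S\<inverse> \<subseteq> E" using h(1) by auto
  ultimately show ?thesis unfolding four_cycle_cut_def by blast
qed

lemma four_cycle_distinct:
  assumes "no_short_cycles E" "four_cycle E a b c d"
  shows "distinct [a, b, c, d]"
  using assms(2) no_short_cyclesD(2,3)[OF assms(1)] unfolding four_cycle_def by auto

section \<open>Small cuts around a 4-cycle\<close>

lemma card_Diff_add_1_le:
  assumes "finite A" "y \<in> A" "y \<in> X"
  shows "card (A - X) + 1 \<le> card A"
proof -
  have "A - X \<subset> A" using assms by auto
  then show ?thesis using psubset_card_mono[OF assms(1)] by (simp add: Suc_le_eq)
qed

text \<open>Delete the arcs leaving the cycle. Each of the four vertices keeps the arc to its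
  successor, which accounts for the saving of 4.\<close>

lemma out_cut:
  assumes nsc: "no_short_cycles E" and cyc: "four_cycle E a b c d"
    and outer: "outer_arc E {a, b, c, d}"
  shows "\<exists>S. four_cycle_cut E S \<and> card S + 4 \<le> out_sum E a b c d"
proof -
  let ?C = "{a, b, c, d}"
  let ?N = "\<lambda>x. E `` {x} - ?C"
  define S where "S = E \<inter> ?C \<times> (- ?C)"
  have fin: "finite (E `` {x})" for x
    using no_short_cyclesD(1)[OF nsc] by (simp add: finite_Image)
  have S_eq: "S = {a} \<times> ?N a \<union> {b} \<times> ?N b \<union> {c} \<times> ?N c \<union> {d} \<times> ?N d"
    unfolding S_def by auto
  have N: "card (?N x) + 1 \<le> card (E `` {x})" if "(x, y) \<in> E" "y \<in> ?C" for x y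
    using that by (intro card_Diff_add_1_le[OF fin]) auto
  have "card S \<le> card (?N a) + card (?N b) + card (?N c) + card (?N d)"
    unfolding S_eq by (intro order.trans[OF card_Un_le] add_mono) (simp_all add: card_cartesian_product)
  moreover have "card (?N a) + 1 \<le> card (E `` {a})" "card (?N b) + 1 \<le> card (E `` {b})"
    "card (?N c) + 1 \<le> card (E `` {c})" "card (?N d) + 1 \<le> card (E `` {d})"
    using N[of a b] N[of b c] N[of c d] N[of d a] cyc by (auto simp: four_cycle_def)
  ultimately have "card S + 4 \<le> out_sum E a b c d" unfolding out_sum_def by linarith
  moreover have "four_cycle_cut E S" unfolding four_cycle_cut_def
  proof (intro conjI exI)
    \<comment> \<open>\<open>P\<close> is the cycle, which no remaining arc leaves, and
      \<open>Q\<close> is everything.\<close>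
    show "?C = ?C \<inter> UNIV" by simp
  qed (use cyc outer in \<open>auto simp: S_def four_cycle_def\<close>)
  ultimately show ?thesis by blast
qed

text \<open>The cycle through \<open>y\<close> instead of \<open>b\<close> has an outer arc, so
  \<open>out_cut\<close> applies to it. Its degree sum is too large only if \<open>y\<close> has
  more successors than \<open>b\<close>; then a different cut isolates the new cycle.\<close>

lemma exchange_out_cut:
  assumes nsc: "no_short_cycles E" and cyc: "four_cycle E a b c d"
    and indep: "\<not> outer_arc E {a, b, c, d}" and exch: "exchange E a b c d"
  shows "\<exists>S. four_cycle_cut E S \<and> card S + 4 \<le> out_sum E a b c d"
proof -
  note nscD = no_short_cyclesD[OF nsc]
  obtain y z where yz: "(a, y) \<in> E" "(y, c) \<in> E" "y \<noteq> b" "z \<notin> {a, b, c, d, y}"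
    "(b, z) \<in> E \<or> (z, b) \<in> E"
    using exch unfolding exchange_def by auto
  have E: "(a, b) \<in> E" "(b, c) \<in> E" "(c, d) \<in> E" "(d, a) \<in> E"
    using cyc by (auto simp: four_cycle_def)
  have dist: "distinct [a, b, c, d]" by (rule four_cycle_distinct[OF nsc cyc])
  have fin: "finite (E `` {x})" for x
    using nscD(1) by (simp add: finite_Image)
  have y: "y \<notin> {a, b, c, d}"
    using yz(1-3) nscD(2,3) E by blast
  have y_out: "E `` {y} \<subseteq> {b, c}"
  proof
    fix t assume "t \<in> E `` {y}"
    then have t: "(y, t) \<in> E" by simp
    then have "t \<in> {a, b, c, d}" using indep y unfolding outer_arc_def by blast
    moreover have "t \<noteq> a" using t yz(1) nscD(2) by blast
    moreover have "t \<noteq> d" using t yz(1) E(4) nscD(4) by blast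
    ultimately show "t \<in> {b, c}" by blast
  qed
  let ?C' = "{a, y, c, d}"
  have cyc': "four_cycle E a y c d" using E yz by (auto simp: four_cycle_def)
  have outer': "outer_arc E ?C'"
    unfolding outer_arc_def using yz y dist by auto
  show ?thesis
  proof (cases "card (E `` {y}) \<le> card (E `` {b})")
    case True
    then show ?thesis
      using out_cut[OF nsc cyc' outer'] unfolding out_sum_def by fastforce
  next
    \<comment> \<open>The successors of \<open>y\<close> are among \<open>b\<close> and
      \<open>c\<close>, so this case forces out-degree 1 for \<open>b\<close>, with \<open>c\<close>
      as its only successor.\<close>
    case False
    have "card (E `` {b}) \<ge> 1"
      using E(2) fin[of b] by (metis Image_singleton_iff card_0_eq empty_iff less_one not_less)
    moreover have "card (E `` {y}) \<le> 2"
      using card_mono[OF _ y_out] card_insert_le_m1[of 2 "{c}" b] by force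
    ultimately have card_b: "card (E `` {b}) = 1" using False by linarith
    then have b_out: "E `` {b} = {c}"
      using E(2) by (metis Image_singleton_iff card_1_singletonE singletonD)
    let ?X = "{a, y, c, d, b}"
    let ?N = "\<lambda>x. E `` {x} - ?X"
    text \<open>After deleting the arcs leaving \<open>?X\<close> and the only arc leaving \<open>b\<close>, the vertex \<open>b\<close> is a
      sink; the arc from \<open>y\<close> to \<open>b\<close> need not be deleted.\<close>
    define S where "S = E \<inter> ?X \<times> (- ?X) \<union> {(b, c)}"
    have S_eq: "S = {a} \<times> ?N a \<union> {c} \<times> ?N c \<union> {d} \<times> ?N d \<union> {(b, c)}"
      unfolding S_def using y_out b_out by auto
    have N: "card (?N x) + 1 \<le> card (E `` {x})" if "(x, t) \<in> E" "t \<in> ?X" for x t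
      using that by (intro card_Diff_add_1_le[OF fin]) auto
    have "card S \<le> card (?N a) + card (?N c) + card (?N d) + 1"
      unfolding S_eq by (intro order.trans[OF card_Un_le] add_mono) (simp_all add: card_cartesian_product)
    moreover have "card (?N c) + 1 \<le> card (E `` {c})" "card (?N d) + 1 \<le> card (E `` {d})"
      using N[of c d] N[of d a] E by auto
    \<comment> \<open>The arcs from \<open>a\<close> to \<open>b\<close> and to \<open>y\<close>
      both stay inside \<open>?X\<close>. This second saving at \<open>a\<close> makes up for the
      deleted arc \<open>(b, c)\<close>.\<close>
    moreover have "card (?N a) + 2 \<le> card (E `` {a})"
    proof -
      have "card (?N a) \<le> card (E `` {a} - {b, y})"
        using fin by (intro card_mono) auto
      also have "\<dots> = card (E `` {a}) - 2"
        using E(1) yz(1,3) by (subst card_Diff_subset) auto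
      finally show ?thesis
        using card_mono[of "E `` {a}" "{b, y}"] fin E(1) yz(1,3) by auto
    qed
    ultimately have "card S + 4 \<le> out_sum E a b c d"
      unfolding out_sum_def card_b by linarith
    moreover have "four_cycle_cut E S" unfolding four_cycle_cut_def
    proof (intro conjI exI)
      \<comment> \<open>\<open>P\<close> is \<open>?X\<close>, which no remaining arc leaves, and
        \<open>Q\<close> is the complement of the sink \<open>b\<close>.\<close>
      show "?C' = ?X \<inter> - {b}" using dist y by auto
      show "four_cycle (E - S) a y c d"
        using cyc' y dist by (auto simp: S_def four_cycle_def)
      show "(E - S)\<inverse> `` (- {b}) \<subseteq> - {b}" using b_out by (auto simp: S_def)
    qed (use E outer' in \<open>auto simp: S_def\<close>)
    ultimately show ?thesis by blast
  qed
qed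

lemma cut_le_out_sum:
  assumes "no_short_cycles E" "four_cycle E a b c d"
    and "outer_arc E {a, b, c, d} \<or> exchange E a b c d"
  shows "\<exists>S. four_cycle_cut E S \<and> card S + 4 \<le> out_sum E a b c d"
  using assms out_cut exchange_out_cut by metis

text \<open>Reverse all arcs. Reading the cycle as \<open>c b a d\<close> leaves \<open>b\<close>
  and \<open>d\<close> in place, so that \<open>exchange\<close> is preserved.\<close>

lemma cut_le_in_sum:
  assumes "no_short_cycles E" "four_cycle E a b c d"
    and "outer_arc E {a, b, c, d} \<or> exchange E a b c d"
  shows "\<exists>S. four_cycle_cut E S \<and> card S + 4 \<le> out_sum (E\<inverse>) a b c d"
proof -
  have "{c, b, a, d} = {a, b, c, d}" by auto
  then obtain S where S: "four_cycle_cut (E\<inverse>) S" "card S + 4 \<le> out_sum (E\<inverse>) c b a d"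
    using cut_le_out_sum[of "E\<inverse>" c b a d] assms
    by (auto simp: four_cycle_converse exchange_converse)
  moreover have "out_sum (E\<inverse>) c b a d = out_sum (E\<inverse>) a b c d"
    by (simp add: out_sum_def)
  ultimately show ?thesis
    using four_cycle_cut_converse[of E S] by (metis card_inverse)
qed

section \<open>4-cycles that meet every arc\<close>

text \<open>The case in which \<open>out_cut\<close> fails. Strong connectivity enters through
  \<open>in_arc\<close> and \<open>out_arc\<close>: with \<open>indep\<close> they give each outside
  vertex a predecessor and a successor on the cycle.\<close>

locale dominating_four_cycle =
  fixes V :: "'a set" and E :: "'a rel" and a b c d :: 'a
  assumes nsc: "no_short_cycles E" and cyc: "four_cycle E a b c d"
    and finite_V: "finite V" and E_sub: "E \<subseteq> V \<times> V"
    and indep: "\<not> outer_arc E {a, b, c, d}"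
    and in_arc: "\<And>t. t \<in> V \<Longrightarrow> \<exists>x. (x, t) \<in> E"
    and out_arc: "\<And>t. t \<in> V \<Longrightarrow> \<exists>x. (t, x) \<in> E"
begin

lemma rotate: "dominating_four_cycle V E b c d a"
proof -
  have "{b, c, d, a} = {a, b, c, d}" by auto
  then show ?thesis
    using nsc cyc finite_V E_sub indep in_arc out_arc
    by unfold_locales (auto simp: four_cycle_def)
qed

lemma arcs: "(a, b) \<in> E" "(b, c) \<in> E" "(c, d) \<in> E" "(d, a) \<in> E"
  using cyc by (auto simp: four_cycle_def)

lemma dist: "distinct [a, b, c, d]"
  by (rule four_cycle_distinct[OF nsc cyc])

lemma in_V: "a \<in> V" "b \<in> V" "c \<in> V" "d \<in> V"
  using arcs E_sub by auto

text \<open>The cycle has no chords: an arc between opposite vertices would close a triangle in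
  either direction.\<close>

lemma arc_cases:
  assumes "(x, y) \<in> E"
  shows "(x, y) \<in> {(a, b), (b, c), (c, d), (d, a)} \<or>
    x \<in> {a, b, c, d} \<and> y \<in> V - {a, b, c, d} \<or> x \<in> V - {a, b, c, d} \<and> y \<in> {a, b, c, d}"
proof -
  have "x \<in> V" "y \<in> V" using assms E_sub by auto
  moreover have "x \<in> {a, b, c, d} \<or> y \<in> {a, b, c, d}"
    using assms indep unfolding outer_arc_def by auto
  moreover have "(x, y) \<in> {(a, b), (b, c), (c, d), (d, a)}"
    if "x \<in> {a, b, c, d}" "y \<in> {a, b, c, d}"
    using that assms arcs no_short_cyclesD(2-4)[OF nsc] by blast
  ultimately show ?thesis by blast
qed

lemma in_neighbour:
  assumes "t \<in> V - {a, b, c, d}"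
  shows "(a, t) \<in> E \<or> (b, t) \<in> E \<or> (c, t) \<in> E \<or> (d, t) \<in> E"
  using assms in_arc[of t] indep unfolding outer_arc_def by blast

lemma out_neighbour:
  assumes "t \<in> V - {a, b, c, d}"
  shows "(t, a) \<in> E \<or> (t, b) \<in> E \<or> (t, c) \<in> E \<or> (t, d) \<in> E"
  using assms out_arc[of t] indep unfolding outer_arc_def by blast

text \<open>After \<open>a\<close>, an outside vertex cannot lead back to \<open>a\<close> (2-cycle)
  or to \<open>d\<close> (triangle with the arc from \<open>d\<close> to \<open>a\<close>). So among
  the cycle vertices it leads only to \<open>b\<close> or \<open>c\<close>, and likewise in every
  rotation.\<close>

lemma not_via_cycle:
  "(a, t) \<in> E \<Longrightarrow> (t, a) \<notin> E" "(a, t) \<in> E \<Longrightarrow> (t, d) \<notin> E"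
  "(b, t) \<in> E \<Longrightarrow> (t, b) \<notin> E" "(b, t) \<in> E \<Longrightarrow> (t, a) \<notin> E"
  "(c, t) \<in> E \<Longrightarrow> (t, c) \<notin> E" "(c, t) \<in> E \<Longrightarrow> (t, b) \<notin> E"
  "(d, t) \<in> E \<Longrightarrow> (t, d) \<notin> E" "(d, t) \<in> E \<Longrightarrow> (t, c) \<notin> E"
  using arcs no_short_cyclesD(2,4)[OF nsc] by blast+

abbreviation W where "W \<equiv> V - {a, b, c, d}"

lemma V_eq: "V = {a, b, c, d} \<union> W"
  using in_V by auto

text \<open>By \<open>arc_cases\<close> every arc off the cycle joins it to \<open>W\<close>, so it
  suffices to compare arcs at each vertex of \<open>W\<close>.\<close>

lemma arcs_eqI:
  assumes sub: "F \<subseteq> E" and cyc_sub: "{(a, b), (b, c), (c, d), (d, a)} \<subseteq> F"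
    and "\<And>t. t \<in> W \<Longrightarrow> (\<forall>x \<in> {a, b, c, d}. ((x, t) \<in> E \<longrightarrow> (x, t) \<in> F) \<and> ((t, x) \<in> E \<longrightarrow> (t, x) \<in> F))"
  shows "E = F"
proof
  show "E \<subseteq> F"
  proof clarify
    fix x y assume "(x, y) \<in> E"
    from arc_cases[OF this] show "(x, y) \<in> F"
      using \<open>(x, y) \<in> E\<close> assms(2,3) by blast
  qed
qed (rule sub)

text \<open>For consecutive \<open>x\<close> and \<open>y\<close> these vertices bypass an arc of
  the cycle; for opposite ones they bypass a cycle vertex and are the candidates for an
  exchange.\<close>

definition mid :: "'a \<Rightarrow> 'a \<Rightarrow> 'a set" where
  "mid x y = {t \<in> W. (x, t) \<in> E \<and> (t, y) \<in> E}"

lemma finite_mid: "finite (mid x y)"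
  using finite_V unfolding mid_def by auto

lemma mid_disjoint_cycle: "mid x y \<inter> {a, b, c, d} = {}"
  unfolding mid_def by auto

lemma mid_disjoint: "mid x y \<inter> mid y z = {}"
  unfolding mid_def using no_short_cyclesD(2)[OF nsc] by blast

lemma mid_disjoint_opposite: "mid a b \<inter> mid c d = {}" "mid b c \<inter> mid d a = {}"
  unfolding mid_def using not_via_cycle by blast+

lemma via_subset: "A \<subseteq> mid x y \<Longrightarrow> via x A y \<subseteq> E"
  unfolding via_def mid_def by auto

section \<open>Only arcs are bypassed: family H1\<close>

text \<open>By \<open>not_via_cycle\<close> a successor of an outside vertex is next to or opposite
  each of its predecessors. With the opposite case excluded, every outside vertex bypasses a single
  arc and has no further neighbours.\<close>

lemma family_H1_I:
  assumes "mid a c = {}" "mid b d = {}" "mid c a = {}" "mid d b = {}"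
  shows "\<lparr>pverts = V, parcs = E\<rparr> \<in> family_H1"
proof -
  have nmid: "\<not> ((a, t) \<in> E \<and> (t, c) \<in> E)" "\<not> ((b, t) \<in> E \<and> (t, d) \<in> E)"
    "\<not> ((c, t) \<in> E \<and> (t, a) \<in> E)" "\<not> ((d, t) \<in> E \<and> (t, b) \<in> E)" if "t \<in> W" for t
    using assms that unfolding mid_def by blast+
  have type: "t \<in> mid a b \<or> t \<in> mid b c \<or> t \<in> mid c d \<or> t \<in> mid d a" if "t \<in> W" for t
    unfolding mid_def
    using that in_neighbour[OF that] out_neighbour[OF that] nmid[OF that] not_via_cycle[of t] by blast
  have V: "V = {a, b, c, d} \<union> mid a b \<union> mid b c \<union> mid c d \<union> mid d a"
    using type in_V unfolding mid_def by blast
  have E: "E = cycle_arcs [a, b, c, d, a] \<union> via a (mid a b) b \<union> via b (mid b c) c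
      \<union> via c (mid c d) d \<union> via d (mid d a) a"
  proof (rule arcs_eqI, goal_cases)
    case 1 show ?case using arcs by (simp add: via_subset)
  next
    case 2 show ?case by simp
  next
    case (3 t)
    have "(a, t) \<in> E \<Longrightarrow> t \<in> mid a b" "(t, b) \<in> E \<Longrightarrow> t \<in> mid a b"
      "(b, t) \<in> E \<Longrightarrow> t \<in> mid b c" "(t, c) \<in> E \<Longrightarrow> t \<in> mid b c"
      "(c, t) \<in> E \<Longrightarrow> t \<in> mid c d" "(t, d) \<in> E \<Longrightarrow> t \<in> mid c d"
      "(d, t) \<in> E \<Longrightarrow> t \<in> mid d a" "(t, a) \<in> E \<Longrightarrow> t \<in> mid d a"
      using type[OF 3] nmid[OF 3] not_via_cycle[of t] unfolding mid_def by blast+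
    then show ?case unfolding via_def by auto
  qed
  have new: "new_vertex_sets {a, b, c, d} [mid a b, mid b c, mid c d, mid d a]"
    using mid_disjoint[of a b c] mid_disjoint[of b c d] mid_disjoint[of c d a] mid_disjoint[of d a b]
      mid_disjoint_opposite mid_disjoint_cycle
    by (auto simp: finite_mid)
  show ?thesis
    unfolding family_H1_def mem_Collect_eq
    by (intro exI conjI)
      (rule arg_cong2[where f = "\<lambda>v e. \<lparr>pverts = v, parcs = e\<rparr>", OF V E], rule dist, rule new)
qed

section \<open>Bypasses of both \<open>b\<close> and \<open>d\<close>: families H2, H4, H5 and
  H7\<close>

context
  fixes x y
  assumes x: "x \<in> mid c a" and y: "y \<in> mid a c" and W_eq: "W = mid a c \<union> mid c a"
begin

lemma dist_xy: "distinct [a, b, c, d, x, y]"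
  using dist x y mid_disjoint[of a c a] unfolding mid_def by auto

text \<open>The two parts of \<open>W\<close> use the arcs at \<open>a\<close> and \<open>c\<close>
  in opposite directions, so one such arc decides the part. Only the arcs at \<open>b\<close> and
  \<open>d\<close> distinguish the four families.\<close>

lemma mem_mid:
  assumes "t \<in> W"
  shows "(a, t) \<in> E \<Longrightarrow> t \<in> mid a c" "(t, c) \<in> E \<Longrightarrow> t \<in> mid a c"
    "(c, t) \<in> E \<Longrightarrow> t \<in> mid c a" "(t, a) \<in> E \<Longrightarrow> t \<in> mid c a"
  using assms W_eq not_via_cycle[of t] unfolding mid_def by blast+

lemma family_H2_I:
  assumes b: "\<And>t. t \<in> W \<Longrightarrow> (b, t) \<notin> E \<and> (t, b) \<notin> E" and d: "\<And>t. t \<in> W \<Longrightarrow> (d, t) \<notin> E \<and> (t, d) \<notin> E"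
  shows "\<lparr>pverts = V, parcs = E\<rparr> \<in> family_H2"
proof -
  \<comment> \<open>\<open>x\<close> becomes the named vertex of the second 4-cycle, so it is taken
    out of the attached set.\<close>
  let ?A = "mid c a - {x}" and ?B = "mid a c"
  have V: "V = {a, b, c, d, x} \<union> ?A \<union> ?B"
    using V_eq x y unfolding W_eq by blast
  have E: "E = cycle_arcs [a, b, c, d, a] \<union> cycle_arcs [a, b, c, x, a] \<union> via c ?A a \<union> via a ?B c"
  proof (rule arcs_eqI, goal_cases)
    case 1 show ?case using arcs x via_subset[of ?A c a] by (auto simp: via_subset mid_def)
  next
    case 2 show ?case by simp
  next
    case (3 t)
    then show ?case using b[OF 3] d[OF 3] mem_mid[OF 3] unfolding via_def by auto
  qed
  have new: "new_vertex_sets {a, b, c, d, x} [?A, ?B]"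
    using mid_disjoint[of a c a] mid_disjoint_cycle x by (auto simp: finite_mid)
  have dist5: "distinct [a, b, c, d, x]" using dist_xy by auto
  show ?thesis
    unfolding family_H2_def mem_Collect_eq
    by (intro exI conjI)
      (rule arg_cong2[where f = "\<lambda>v e. \<lparr>pverts = v, parcs = e\<rparr>", OF V E], rule dist5, rule new)
qed

lemma family_H4_I:
  assumes P: "mid a c = {y}" and e: "e \<in> {(y, b), (b, y)}" "e \<in> E"
    and d: "\<And>t. t \<in> W \<Longrightarrow> (d, t) \<notin> E \<and> (t, d) \<notin> E"
    and b: "\<And>t. t \<in> W \<Longrightarrow> (b, t) \<in> E \<or> (t, b) \<in> E \<Longrightarrow> t = y"
  shows "\<lparr>pverts = V, parcs = E\<rparr> \<in> family_H4"
proof -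
  let ?A = "mid c a - {x}"
  have V: "V = {a, b, c, d, x, y} \<union> ?A"
    using V_eq x y P unfolding W_eq by blast
  have E: "E = cycle_arcs [a, b, c, d, a] \<union> cycle_arcs [a, b, c, x, a]
      \<union> {(a, y), (y, c), e} \<union> via c ?A a"
  proof (rule arcs_eqI, goal_cases)
    case 1 show ?case using arcs x y e(2) via_subset[of ?A c a] by (auto simp: mid_def)
  next
    case 2 show ?case by simp
  next
    case (3 t)
    \<comment> \<open>A neighbour \<open>t\<close> of \<open>b\<close> is \<open>y\<close>, and
      \<open>y\<close> and \<open>b\<close> are joined in one direction only.\<close>
    have "(b, t) \<in> E \<Longrightarrow> e = (b, t)" "(t, b) \<in> E \<Longrightarrow> e = (t, b)"
      using b[OF 3] e no_short_cyclesD(2)[OF nsc] by blast+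
    then show ?case using d[OF 3] mem_mid[OF 3] unfolding P via_def by auto
  qed
  have new: "new_vertex_sets {a, b, c, d, x, y} [?A]"
    using mid_disjoint[of a c a] mid_disjoint_cycle x y by (auto simp: finite_mid)
  show ?thesis
    unfolding family_H4_def mem_Collect_eq
    by (intro exI conjI)
      (rule arg_cong2[where f = "\<lambda>v e. \<lparr>pverts = v, parcs = e\<rparr>", OF V E],
        rule dist_xy, rule e(1), rule new)
qed

lemma family_H5_I:
  assumes Q: "mid c a = {x}" and e: "e \<in> {(x, d), (d, x)}" "e \<in> E"
    and b: "\<And>t. t \<in> W \<Longrightarrow> (b, t) \<notin> E \<and> (t, b) \<notin> E"
    and d: "\<And>t. t \<in> W \<Longrightarrow> (d, t) \<in> E \<or> (t, d) \<in> E \<Longrightarrow> t = x"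
  shows "\<lparr>pverts = V, parcs = E\<rparr> \<in> family_H5"
proof -
  let ?A = "mid a c"
  have V: "V = {a, b, c, d, x} \<union> ?A"
    using V_eq x y Q unfolding W_eq by blast
  have E: "E = cycle_arcs [a, b, c, d, a] \<union> cycle_arcs [a, b, c, x, a] \<union> {e} \<union> via a ?A c"
  proof (rule arcs_eqI, goal_cases)
    case 1 show ?case using arcs x y e(2) via_subset[of ?A a c] by (auto simp: mid_def)
  next
    case 2 show ?case by simp
  next
    case (3 t)
    have "(d, t) \<in> E \<Longrightarrow> e = (d, t)" "(t, d) \<in> E \<Longrightarrow> e = (t, d)"
      using d[OF 3] e no_short_cyclesD(2)[OF nsc] by blast+
    then show ?case using b[OF 3] mem_mid[OF 3] unfolding Q via_def by auto
  qed
  have new: "new_vertex_sets {a, b, c, d, x} [?A]"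
    using mid_disjoint[of a c a] mid_disjoint_cycle x by (auto simp: finite_mid)
  have dist5: "distinct [a, b, c, d, x]" using dist_xy by auto
  show ?thesis
    unfolding family_H5_def mem_Collect_eq
    by (intro exI conjI)
      (rule arg_cong2[where f = "\<lambda>v e. \<lparr>pverts = v, parcs = e\<rparr>", OF V E],
        rule dist5, rule e(1), rule new)
qed

lemma family_H7_I:
  assumes P: "mid a c = {y}" and Q: "mid c a = {x}"
    and e: "e \<in> {(x, d), (d, x)}" "e \<in> E" and f: "f \<in> {(y, b), (b, y)}" "f \<in> E"
    and b: "\<And>t. t \<in> W \<Longrightarrow> (b, t) \<in> E \<or> (t, b) \<in> E \<Longrightarrow> t = y"
    and d: "\<And>t. t \<in> W \<Longrightarrow> (d, t) \<in> E \<or> (t, d) \<in> E \<Longrightarrow> t = x"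
  shows "\<lparr>pverts = V, parcs = E\<rparr> \<in> family_H7"
proof -
  have V: "V = {a, b, c, d, x, y}"
    using V_eq x y P Q unfolding W_eq by blast
  have E: "E = cycle_arcs [a, b, c, d, a] \<union> cycle_arcs [a, b, c, x, a] \<union> {e, f} \<union> {(a, y), (y, c)}"
  proof (rule arcs_eqI, goal_cases)
    case 1 show ?case using arcs x y e(2) f(2) by (auto simp: mid_def)
  next
    case 2 show ?case by simp
  next
    case (3 t)
    have "(d, t) \<in> E \<Longrightarrow> e = (d, t)" "(t, d) \<in> E \<Longrightarrow> e = (t, d)"
      "(b, t) \<in> E \<Longrightarrow> f = (b, t)" "(t, b) \<in> E \<Longrightarrow> f = (t, b)"
      using d[OF 3] e b[OF 3] f no_short_cyclesD(2)[OF nsc] by blast+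
    then show ?case using mem_mid[OF 3] unfolding P Q by auto
  qed
  show ?thesis
    unfolding family_H7_def mem_Collect_eq
    by (intro exI conjI)
      (rule arg_cong2[where f = "\<lambda>v e. \<lparr>pverts = v, parcs = e\<rparr>", OF V E],
        rule dist_xy, rule e(1), rule f(1))
qed

end

section \<open>Bypasses of \<open>b\<close> but none of \<open>d\<close>: families H3 and H6\<close>

context
  fixes y
  assumes y: "y \<in> mid a c" and no_mid: "mid c a = {}"
    and b: "\<And>t. t \<in> W \<Longrightarrow> (b, t) \<in> E \<or> (t, b) \<in> E \<Longrightarrow> t = y"
begin

lemma dist_y: "distinct [c, d, a, b, y]"
  using dist y unfolding mid_def by auto

text \<open>A neighbour of \<open>b\<close> in \<open>W\<close> is \<open>y\<close>, which lies in
  \<open>mid a c\<close>. Any other vertex of \<open>W\<close> has its neighbours among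
  \<open>a\<close>, \<open>c\<close>, \<open>d\<close>, where \<open>not_via_cycle\<close> and
  \<open>no_mid\<close> leave three types.\<close>

lemma mem_mid_one_sided:
  assumes "t \<in> W"
  shows "t \<in> mid a c \<or> t \<in> mid c d \<or> t \<in> mid d a"
    and "(a, t) \<in> E \<Longrightarrow> t \<in> mid a c" "(t, c) \<in> E \<Longrightarrow> t \<in> mid a c"
    "(c, t) \<in> E \<Longrightarrow> t \<in> mid c d" "(t, d) \<in> E \<Longrightarrow> t \<in> mid c d"
    "(d, t) \<in> E \<Longrightarrow> t \<in> mid d a" "(t, a) \<in> E \<Longrightarrow> t \<in> mid d a"
proof -
  have no: "\<not> ((c, t) \<in> E \<and> (t, a) \<in> E)" using no_mid assms unfolding mid_def by blast
  have bt: "(a, t) \<in> E \<and> (t, c) \<in> E" if "(b, t) \<in> E \<or> (t, b) \<in> E"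
    using b[OF assms that] y unfolding mid_def by blast
  show type: "t \<in> mid a c \<or> t \<in> mid c d \<or> t \<in> mid d a"
    unfolding mid_def
    using assms no bt in_neighbour[OF assms] out_neighbour[OF assms] not_via_cycle[of t] by blast
  show "(a, t) \<in> E \<Longrightarrow> t \<in> mid a c" "(t, c) \<in> E \<Longrightarrow> t \<in> mid a c"
    "(c, t) \<in> E \<Longrightarrow> t \<in> mid c d" "(t, d) \<in> E \<Longrightarrow> t \<in> mid c d"
    "(d, t) \<in> E \<Longrightarrow> t \<in> mid d a" "(t, a) \<in> E \<Longrightarrow> t \<in> mid d a"
    using type no not_via_cycle[of t] unfolding mid_def by blast+
qed

lemma W_one_sided: "W = mid a c \<union> mid c d \<union> mid d a"
  using mem_mid_one_sided(1) unfolding mid_def by blast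

lemma family_H3_I:
  assumes nb: "\<And>t. t \<in> W \<Longrightarrow> (b, t) \<notin> E \<and> (t, b) \<notin> E"
  shows "\<lparr>pverts = V, parcs = E\<rparr> \<in> family_H3"
proof -
  let ?C = "mid a c - {y}"
  have V: "V = {c, d, a, b, y} \<union> mid c d \<union> mid d a \<union> ?C"
    using V_eq y unfolding W_one_sided by blast
  \<comment> \<open>The family is read from \<open>c\<close> on: \<open>c, d, a, b, y\<close> take
    the places of \<open>u, v, w, z, x\<close>.\<close>
  have E: "E = cycle_arcs [c, d, a, b, c] \<union> cycle_arcs [c, d, a, y, c]
      \<union> via c (mid c d) d \<union> via d (mid d a) a \<union> via a ?C c"
  proof (rule arcs_eqI, goal_cases)
    case 1 show ?case using arcs y via_subset[of ?C a c] by (auto simp: via_subset mid_def)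
  next
    case 2 show ?case by simp
  next
    case (3 t)
    then show ?case using nb[OF 3] mem_mid_one_sided(2-)[OF 3] unfolding via_def by auto
  qed
  have new: "new_vertex_sets {c, d, a, b, y} [mid c d, mid d a, ?C]"
    using mid_disjoint[of a c d] mid_disjoint[of d a c] mid_disjoint[of c d a]
      mid_disjoint_cycle y by (auto simp: finite_mid)
  show ?thesis
    unfolding family_H3_def mem_Collect_eq
    by (intro exI conjI)
      (rule arg_cong2[where f = "\<lambda>v e. \<lparr>pverts = v, parcs = e\<rparr>", OF V E], rule dist_y, rule new)
qed

lemma family_H6_I:
  assumes P: "mid a c = {y}" and e: "e \<in> {(y, b), (b, y)}" "e \<in> E"
  shows "\<lparr>pverts = V, parcs = E\<rparr> \<in> family_H6"
proof -
  have V: "V = {c, d, a, b, y} \<union> mid c d \<union> mid d a"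
    using V_eq y P unfolding W_one_sided by blast
  have E: "E = cycle_arcs [c, d, a, b, c] \<union> cycle_arcs [c, d, a, y, c] \<union> {e}
      \<union> via c (mid c d) d \<union> via d (mid d a) a"
  proof (rule arcs_eqI, goal_cases)
    case 1 show ?case using arcs y e(2) by (auto simp: via_subset mid_def)
  next
    case 2 show ?case by simp
  next
    case (3 t)
    have "(b, t) \<in> E \<Longrightarrow> e = (b, t)" "(t, b) \<in> E \<Longrightarrow> e = (t, b)"
      using b[OF 3] e no_short_cyclesD(2)[OF nsc] by blast+
    then show ?case using mem_mid_one_sided(2-)[OF 3] unfolding P via_def by auto
  qed
  have new: "new_vertex_sets {c, d, a, b, y} [mid c d, mid d a]"
    using mid_disjoint[of a c d] mid_disjoint[of d a c] mid_disjoint[of c d a]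
      mid_disjoint_cycle y by (auto simp: finite_mid)
  show ?thesis
    unfolding family_H6_def mem_Collect_eq
    by (intro exI conjI)
      (rule arg_cong2[where f = "\<lambda>v e. \<lparr>pverts = v, parcs = e\<rparr>", OF V E],
        rule dist_y, rule e(1), rule new)
qed

end

section \<open>Classification when no exchange is possible\<close>

lemma exchange_unique:
  assumes "\<not> exchange E a b c d" "y \<in> mid a c" "t \<in> W" "(b, t) \<in> E \<or> (t, b) \<in> E"
  shows "t = y"
  using assms unfolding exchange_def mid_def by blast

text \<open>If \<open>mid c a\<close> is empty, the family is H6 or H3 according to whether
  \<open>b\<close> has a neighbour in \<open>W\<close>. Otherwise it is H7 if both \<open>b\<close>
  and \<open>d\<close> have one, H4 if only \<open>b\<close>, H5 if only \<open>d\<close>, and H2 if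
  neither.\<close>

lemma exceptional_if_mid:
  assumes exch: "\<not> exchange E a b c d" "\<not> exchange E c d a b" and mid: "mid a c \<noteq> {}"
  shows "\<lparr>pverts = V, parcs = E\<rparr> \<in> exceptional_digraphs"
proof -
  \<comment> \<open>Two rotations swap \<open>b\<close> and \<open>d\<close>, so facts about
    \<open>b\<close> carry over to \<open>d\<close>.\<close>
  interpret opp: dominating_four_cycle V E c d a b
    using dominating_four_cycle.rotate[OF rotate] .
  have opp_mid: "opp.mid u v = mid u v" for u v
    unfolding mid_def opp.mid_def by blast
  have b: "t = y" if "y \<in> mid a c" "t \<in> W" "(b, t) \<in> E \<or> (t, b) \<in> E" for y t
    using exchange_unique[OF exch(1)] that by blast
  have d: "t = x" if "x \<in> mid c a" "t \<in> W" "(d, t) \<in> E \<or> (t, d) \<in> E" for x t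
    using opp.exchange_unique[OF exch(2)] that unfolding opp_mid by blast
  \<comment> \<open>Every neighbour of \<open>b\<close> in \<open>W\<close> equals every element of
    \<open>mid a c\<close>, so one neighbour makes this set a singleton.\<close>
  have b_adj: "\<exists>e. mid a c = {y} \<and> e \<in> {(y, b), (b, y)} \<and> e \<in> E"
    if h: "y \<in> mid a c" "\<exists>t \<in> W. (b, t) \<in> E \<or> (t, b) \<in> E" for y
  proof -
    obtain t where t: "t \<in> W" "(b, t) \<in> E \<or> (t, b) \<in> E" using h(2) by blast
    then have "mid a c = {t}" using b h(1) by blast
    then show ?thesis using t(2) h(1) by auto
  qed
  have d_adj: "\<exists>e. mid c a = {x} \<and> e \<in> {(x, d), (d, x)} \<and> e \<in> E"
    if h: "x \<in> mid c a" "\<exists>t \<in> W. (d, t) \<in> E \<or> (t, d) \<in> E" for x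
  proof -
    obtain t where t: "t \<in> W" "(d, t) \<in> E \<or> (t, d) \<in> E" using h(2) by blast
    then have "mid c a = {t}" using d h(1) by blast
    then show ?thesis using t(2) h(1) by auto
  qed
  obtain y where y: "y \<in> mid a c" using mid by blast
  note b' = b[OF y]
  have b_cases: "(\<exists>e. mid a c = {y} \<and> e \<in> {(y, b), (b, y)} \<and> e \<in> E) \<or>
      (\<forall>t \<in> W. (b, t) \<notin> E \<and> (t, b) \<notin> E)"
    using b_adj[OF y] by blast
  have "\<lparr>pverts = V, parcs = E\<rparr> \<in> family_H2 \<union> family_H3 \<union> family_H4 \<union> family_H5 \<union> family_H6 \<union> family_H7"
  proof (cases "mid c a = {}")
    case no_mid: True
    from b_cases show ?thesis
    proof
      assume "\<exists>e. mid a c = {y} \<and> e \<in> {(y, b), (b, y)} \<and> e \<in> E"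
      then obtain e where e: "mid a c = {y}" "e \<in> {(y, b), (b, y)}" "e \<in> E" by blast
      have "\<lparr>pverts = V, parcs = E\<rparr> \<in> family_H6"
        by (rule family_H6_I[OF y no_mid _ e]) (rule b')
      then show ?thesis by blast
    next
      assume "\<forall>t \<in> W. (b, t) \<notin> E \<and> (t, b) \<notin> E"
      then have "\<lparr>pverts = V, parcs = E\<rparr> \<in> family_H3"
        by (intro family_H3_I[OF y no_mid]) (erule b', assumption, blast)
      then show ?thesis by blast
    qed
  next
    case False
    then obtain x where x: "x \<in> mid c a" by blast
    note d' = d[OF x]
    have d_cases: "(\<exists>e. mid c a = {x} \<and> e \<in> {(x, d), (d, x)} \<and> e \<in> E) \<or>
        (\<forall>t \<in> W. (d, t) \<notin> E \<and> (t, d) \<notin> E)"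
      using d_adj[OF x] by blast
    \<comment> \<open>Neighbours of \<open>b\<close> and \<open>d\<close> in \<open>W\<close> are
      \<open>y\<close> and \<open>x\<close>; any other vertex of \<open>W\<close> sees only
      \<open>a\<close> and \<open>c\<close>, hence goes from one to the other.\<close>
    have W_eq: "W = mid a c \<union> mid c a"
    proof
      show "W \<subseteq> mid a c \<union> mid c a"
      proof
        fix t assume t: "t \<in> W"
        have "t \<in> mid a c" if "(b, t) \<in> E \<or> (t, b) \<in> E" using b'[OF t that] y by simp
        moreover have "t \<in> mid c a" if "(d, t) \<in> E \<or> (t, d) \<in> E" using d'[OF t that] x by simp
        ultimately show "t \<in> mid a c \<union> mid c a"
          using in_neighbour[OF t] out_neighbour[OF t] not_via_cycle[of t] t
          unfolding mid_def by (elim disjE) simp_all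
      qed
    qed (auto simp: mid_def)
    note mid_xy = x y W_eq
    from b_cases show ?thesis
    proof
      assume "\<exists>e. mid a c = {y} \<and> e \<in> {(y, b), (b, y)} \<and> e \<in> E"
      then obtain e where P: "mid a c = {y}" and e: "e \<in> {(y, b), (b, y)}" "e \<in> E" by blast
      from d_cases show ?thesis
      proof
        assume "\<exists>e. mid c a = {x} \<and> e \<in> {(x, d), (d, x)} \<and> e \<in> E"
        then obtain f where Q: "mid c a = {x}" and f: "f \<in> {(x, d), (d, x)}" "f \<in> E" by blast
        have "\<lparr>pverts = V, parcs = E\<rparr> \<in> family_H7"
          by (rule family_H7_I[OF mid_xy P Q f e]) (erule b' d', assumption)+
        then show ?thesis by blast
      next
        assume "\<forall>t \<in> W. (d, t) \<notin> E \<and> (t, d) \<notin> E"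
        then have "\<lparr>pverts = V, parcs = E\<rparr> \<in> family_H4"
          by (intro family_H4_I[OF mid_xy P e]) (blast, erule b', assumption)
        then show ?thesis by blast
      qed
    next
      assume no_b: "\<forall>t \<in> W. (b, t) \<notin> E \<and> (t, b) \<notin> E"
      from d_cases show ?thesis
      proof
        assume "\<exists>e. mid c a = {x} \<and> e \<in> {(x, d), (d, x)} \<and> e \<in> E"
        then obtain f where Q: "mid c a = {x}" and f: "f \<in> {(x, d), (d, x)}" "f \<in> E" by blast
        have "\<lparr>pverts = V, parcs = E\<rparr> \<in> family_H5"
          using no_b by (intro family_H5_I[OF mid_xy Q f]) (blast, erule d', assumption)
        then show ?thesis by blast
      next
        assume "\<forall>t \<in> W. (d, t) \<notin> E \<and> (t, d) \<notin> E"
        then have "\<lparr>pverts = V, parcs = E\<rparr> \<in> family_H2"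
          using no_b by (intro family_H2_I[OF mid_xy]) blast+
        then show ?thesis by blast
      qed
    qed
  qed
  then show ?thesis unfolding exceptional_digraphs_def by blast
qed

text \<open>If some opposite pair has a nonempty \<open>mid\<close>, a rotation brings it to
  \<open>mid a c\<close>; if none has, the family is H1.\<close>

lemma exceptional:
  assumes exch: "\<not> exchange E a b c d" "\<not> exchange E b c d a"
    "\<not> exchange E c d a b" "\<not> exchange E d a b c"
  shows "\<lparr>pverts = V, parcs = E\<rparr> \<in> exceptional_digraphs"
proof -
  interpret rot1: dominating_four_cycle V E b c d a by (rule rotate)
  interpret rot2: dominating_four_cycle V E c d a b by (rule rot1.rotate)
  interpret rot3: dominating_four_cycle V E d a b c by (rule rot2.rotate)
  have "rot1.mid u v = mid u v" "rot2.mid u v = mid u v" "rot3.mid u v = mid u v" for u v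
    unfolding mid_def rot1.mid_def rot2.mid_def rot3.mid_def by blast+
  then show ?thesis
    using exceptional_if_mid rot1.exceptional_if_mid rot2.exceptional_if_mid rot3.exceptional_if_mid
      exch family_H1_I unfolding exceptional_digraphs_def by (metis UnI1)
qed

end

section \<open>Cuts outside the exceptional families\<close>

lemma exists_four_cycle_cut:
  assumes nsc: "no_short_cycles E" and cyc: "four_cycle E a b c d"
    and "finite V" "E \<subseteq> V \<times> V"
    and "\<And>t. t \<in> V \<Longrightarrow> \<exists>x. (x, t) \<in> E" "\<And>t. t \<in> V \<Longrightarrow> \<exists>x. (t, x) \<in> E"
    and not_exc: "\<lparr>pverts = V, parcs = E\<rparr> \<notin> exceptional_digraphs"
  shows "\<exists>S. four_cycle_cut E S \<and> card S + 4 \<le> min (out_sum E a b c d) (out_sum (E\<inverse>) a b c d)"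
proof -
  \<comment> \<open>The out-degree and in-degree bounds come from different cuts; the one for the
    smaller sum is chosen.\<close>
  have both: "\<exists>S. four_cycle_cut E S \<and> card S + 4 \<le> min (out_sum E p q r s) (out_sum (E\<inverse>) p q r s)"
    if "four_cycle E p q r s" "outer_arc E {p, q, r, s} \<or> exchange E p q r s" for p q r s
    using cut_le_out_sum[OF nsc that] cut_le_in_sum[OF nsc that] by (metis min_def)
  have exch: "outer_arc E {a, b, c, d} \<or> exchange E a b c d \<or> exchange E b c d a
      \<or> exchange E c d a b \<or> exchange E d a b c"
  proof (rule ccontr)
    assume no: "\<not> ?thesis"
    interpret dominating_four_cycle V E a b c d
      using assms no by unfold_locales auto
    show False using exceptional no not_exc by blast
  qed
  have cycs: "four_cycle E b c d a" "four_cycle E c d a b" "four_cycle E d a b c"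
    using cyc by (auto simp: four_cycle_def)
  have "out_sum R b c d a = out_sum R a b c d" "out_sum R c d a b = out_sum R a b c d"
    "out_sum R d a b c = out_sum R a b c d" for R :: "'a rel"
    by (simp_all add: out_sum_def)
  then show ?thesis
    using exch both[OF cyc] both[OF cycs(1)] both[OF cycs(2)] both[OF cycs(3)] by auto
qed

section \<open>Transfer to digraphs, connectivity and \<open>xi\<close>\<close>

lemma restricted_arc_cut_if_four_cycle_cut:
  assumes D: "pair_digraph D" and cut: "four_cycle_cut (parcs D) S"
  shows "restricted_arc_cut D S"
proof -
  interpret pair_digraph D by (rule D)
  obtain a b c d P Q where S: "S \<subseteq> parcs D" and cyc: "four_cycle (parcs D - S) a b c d"
    and PQ: "{a, b, c, d} = P \<inter> Q" "(parcs D - S) `` P \<subseteq> P" "(parcs D - S)\<inverse> `` Q \<subseteq> Q"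
    and outer: "outer_arc (parcs D) {a, b, c, d}"
    using cut unfolding four_cycle_cut_def by blast
  let ?C = "{a, b, c, d}" and ?G = "del_arcs D S"
  interpret G: pair_wf_digraph ?G
    using wellformed' by unfold_locales (auto simp: del_arcs_def)
  have arcs_G: "parcs ?G = parcs D - S" by (simp add: del_arcs_def)
  have C_sub: "?C \<subseteq> pverts D"
    using cyc wellformed' unfolding four_cycle_def by blast
  have arc: "(a, b) \<in> parcs ?G" "(b, c) \<in> parcs ?G" "(c, d) \<in> parcs ?G" "(d, a) \<in> parcs ?G"
    using cyc unfolding four_cycle_def arcs_G by auto
  then have step: "a \<rightarrow>\<^sup>*\<^bsub>?G\<^esub> b" "b \<rightarrow>\<^sup>*\<^bsub>?G\<^esub> c" "c \<rightarrow>\<^sup>*\<^bsub>?G\<^esub> d" "d \<rightarrow>\<^sup>*\<^bsub>?G\<^esub> a"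
    by (auto intro: G.reachable_adjI)
  have refl: "a \<rightarrow>\<^sup>*\<^bsub>?G\<^esub> a"
    using step by (meson G.reachable_trans)
  have P_closed: "v \<in> P" if "u \<rightarrow>\<^sup>*\<^bsub>?G\<^esub> v" "u \<in> P" for u v
    using that PQ(2) unfolding reachable_def
    by (induction rule: rtrancl_on_induct) (auto simp: arcs_G)
  have Q_closed: "u \<in> Q" if "u \<rightarrow>\<^sup>*\<^bsub>?G\<^esub> v" "v \<in> Q" for u v
    using that PQ(3) unfolding reachable_def
    by (induction rule: converse_rtrancl_on_induct) (auto simp: arcs_G)
  have "?C \<in> pre_digraph.sccs_verts ?G"
    unfolding G.in_sccs_verts_conv_reachable
  proof (intro conjI ballI allI impI)
    fix u v assume "u \<in> ?C" "v \<in> ?C"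
    then have "u \<rightarrow>\<^sup>*\<^bsub>?G\<^esub> a" "a \<rightarrow>\<^sup>*\<^bsub>?G\<^esub> v"
      using step refl by (auto intro: G.reachable_trans)
    then show "u \<rightarrow>\<^sup>*\<^bsub>?G\<^esub> v" by (rule G.reachable_trans)
  next
    fix u v assume "u \<in> ?C" "v \<notin> ?C"
    \<comment> \<open>If \<open>v\<close> is not in \<open>P\<close>, then \<open>u\<close> cannot
      reach it; if \<open>v\<close> is not in \<open>Q\<close>, it cannot reach
      \<open>u\<close>.\<close>
    then show "\<not> u \<rightarrow>\<^sup>*\<^bsub>?G\<^esub> v \<or> \<not> v \<rightarrow>\<^sup>*\<^bsub>?G\<^esub> u"
      using P_closed Q_closed unfolding PQ(1) by blast
  qed simp
  then have scc: "with_proj ?G \<restriction> ?C \<in> pre_digraph.sccs ?G"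
    by (rule G.in_verts_sccsD_sccs)
  have "a \<noteq> b" using arc(1) pair_no_loops[of "(a, b)"] unfolding arcs_G by simp
  then have "card {a, b} = 2" by simp
  moreover have "card {a, b} \<le> card ?C" by (rule card_mono) auto
  ultimately have "card (verts (with_proj ?G \<restriction> ?C)) > 1" by simp
  moreover have "arcs (with_proj D \<restriction> (pverts D - ?C)) \<noteq> {}"
    using outer wellformed' unfolding outer_arc_def by fastforce
  ultimately show ?thesis
    unfolding restricted_arc_cut_def
    by (intro conjI S bexI[where x = "with_proj ?G \<restriction> ?C"] scc) simp_all
qed

text \<open>An end of the arc outside \<open>D1\<close> lies outside a strong component of
  \<open>D - S\<close>, so \<open>D - S\<close> is not strong.\<close>

lemma arc_connectivity_le_restricted_arc_cut:
  assumes D: "pair_digraph D" and cut: "restricted_arc_cut D S"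
  shows "arc_connectivity D \<le> card S"
proof -
  interpret pair_digraph D by (rule D)
  let ?k = "\<lambda>k. \<forall>S \<subseteq> parcs D. card S < k \<longrightarrow> strongly_connected (with_proj (del_arcs D S))"
  let ?G = "with_proj (del_arcs D S)"
  interpret G: pair_wf_digraph "del_arcs D S"
    using wellformed' by unfold_locales (auto simp: del_arcs_def)
  obtain D1 where S: "S \<subseteq> parcs D" and D1: "D1 \<in> pre_digraph.sccs ?G"
    and outside: "arcs (with_proj D \<restriction> (pverts D - verts D1)) \<noteq> {}"
    using cut unfolding restricted_arc_cut_def by blast
  have "\<not> strongly_connected ?G"
  proof
    assume sc: "strongly_connected ?G"
    have "verts D1 \<in> pre_digraph.sccs_verts ?G"
      using D1 by (intro G.in_sccs_vertsI_sccs) simp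
    moreover obtain v where v: "v \<in> pverts D - verts D1"
      using outside by (auto dest: wellformed')
    ultimately obtain u where "u \<in> verts D1"
      "\<not> u \<rightarrow>\<^sup>*\<^bsub>?G\<^esub> v \<or> \<not> v \<rightarrow>\<^sup>*\<^bsub>?G\<^esub> u" "u \<rightarrow>\<^sup>*\<^bsub>?G\<^esub> u"
      unfolding G.in_sccs_verts_conv_reachable by blast
    then show False
      using sc v G.reachable_in_verts(1)[of u u] unfolding strongly_connected_def
      by (auto simp: del_arcs_def)
  qed
  then have bound: "k \<le> card S" if "?k k" for k
    using that S by (meson not_le)
  \<comment> \<open>\<open>Greatest\<close> is meaningful here: 0 qualifies vacuously and
    \<open>card S\<close> is an upper bound.\<close>
  have "?k (Greatest ?k)"
    by (rule GreatestI_nat[where k = 0 and b = "card S"]) (use bound in auto)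
  then show ?thesis
    unfolding arc_connectivity_def by (rule bound)
qed

text \<open>The classification yields family members equal to \<open>D\<close>; reflexivity is what
  makes them contradict the exclusion up to isomorphism.\<close>

lemma digraph_iso_refl:
  assumes "wf_digraph G"
  shows "digraph_iso G G"
  unfolding digraph_iso_def
proof (intro exI conjI)
  interpret wf_digraph G by (rule assms)
  let ?f = "\<lparr>iso_verts = id, iso_arcs = id, iso_head = head G, iso_tail = tail G\<rparr>"
  show "digraph_isomorphism ?f"
    unfolding digraph_isomorphism_def using assms by simp
  show "G = app_iso ?f G" unfolding app_iso_def by simp
qed

lemma strongly_connected_in_out_arc:
  assumes D: "pair_digraph D" and sc: "strongly_connected (with_proj D)"
    and card: "card (pverts D) \<ge> 2" and t: "t \<in> pverts D"
  shows "(\<exists>x. (x, t) \<in> parcs D) \<and> (\<exists>x. (t, x) \<in> parcs D)"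
proof -
  interpret pair_digraph D by (rule D)
  have "\<not> pverts D \<subseteq> {t}"
    using card card_mono[of "{t}" "pverts D"] by auto
  then obtain u where u: "u \<in> pverts D" "u \<noteq> t" by blast
  then have reach: "t \<rightarrow>\<^sup>*\<^bsub>D\<^esub> u" "u \<rightarrow>\<^sup>*\<^bsub>D\<^esub> t"
    using sc t unfolding strongly_connected_def by auto
  have "\<exists>x. (t, x) \<in> parcs D"
    using reach(1) u(2) unfolding reachable_def by (cases rule: converse_rtrancl_on_cases) auto
  moreover have "\<exists>x. (x, t) \<in> parcs D"
    using reach(2) u(2) unfolding reachable_def by (cases rule: rtrancl_on.cases) auto
  ultimately show ?thesis by blast
qed

lemma girth_le_length: "pre_digraph.cycle (with_proj D) p \<Longrightarrow> girth D \<le> enat (length p)"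
  unfolding girth_def by (rule INF_lower) simp

lemma no_short_cycles_if_girth:
  assumes D: "oriented_graph D" and girth: "girth D \<ge> 4"
  shows "no_short_cycles (parcs D)"
proof -
  interpret oriented_graph D by (rule D)
  show ?thesis unfolding no_short_cycles_def
  proof (intro conjI allI impI notI)
    fix x y z assume *: "(x, y) \<in> parcs D" "(y, z) \<in> parcs D" "(z, x) \<in> parcs D"
    then have "x \<noteq> y" "y \<noteq> z" "z \<noteq> x" using pair_no_loops by fastforce+
    then have "cycle [(x, y), (y, z), (z, x)]"
      unfolding cycle_def awalk_def using * wellformed' by auto
    from order.trans[OF girth girth_le_length[OF this]] show False
      by (simp add: numeral_eq_enat)
  qed (use pair_finite_arcs no_symmetric_arcs in auto)
qed

lemma out_degree_eq_card_Image: "out_degree (with_proj D) v = card (parcs D `` {v})"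
proof -
  have "out_arcs (with_proj D) v = Pair v ` (parcs D `` {v})"
    by (auto simp: out_arcs_def)
  then show ?thesis by (simp add: out_degree_def card_image inj_on_def)
qed

lemma in_degree_eq_card_Image: "in_degree (with_proj D) v = card ((parcs D)\<inverse> `` {v})"
proof -
  have "in_arcs (with_proj D) v = (\<lambda>u. (u, v)) ` ((parcs D)\<inverse> `` {v})"
    by (auto simp: in_arcs_def)
  then show ?thesis by (simp add: in_degree_def card_image inj_on_def)
qed

text \<open>Infima of nonempty sets in a well-order are attained, first for the girth and then for
  \<open>xi\<close>. Adding 4 on the left avoids the truncated subtraction of
  \<open>xi_cycle\<close>.\<close>

lemma xi_attained:
  assumes D: "pair_digraph D" and girth: "girth D = 4"
  obtains a b c d where "four_cycle (parcs D) a b c d"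
    "xi D + 4 \<ge> min (out_sum (parcs D) a b c d) (out_sum ((parcs D)\<inverse>) a b c d)"
proof -
  interpret pair_digraph D by (rule D)
  let ?cycles = "{p. cycle p}"
  have "?cycles \<noteq> {}"
  proof
    assume none: "?cycles = {}"
    \<comment> \<open>Without cycles the girth would be infinity.\<close>
    show False using girth unfolding girth_def none by (simp add: top_enat_def)
  qed
  then have "girth D \<in> (\<lambda>p. enat (length p)) ` ?cycles"
    unfolding girth_def by (auto intro: wellorder_InfI)
  then have "{p. girth_cycle D p} \<noteq> {}" unfolding girth_cycle_def by auto
  then have "xi D \<in> xi_cycle D ` {p. girth_cycle D p}"
    unfolding xi_def by (auto intro: wellorder_InfI)
  then obtain p where p: "girth_cycle D p" and xi: "xi D = xi_cycle D p" by auto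
  have "length p = 4"
    using p girth unfolding girth_cycle_def by (simp add: numeral_eq_enat)
  then obtain e1 e2 e3 e4 where p_eq: "p = [e1, e2, e3, e4]"
    by (auto simp: length_Suc_conv numeral_eq_Suc)
  have "four_cycle (parcs D) (fst e1) (fst e2) (fst e3) (fst e4)"
    using p unfolding p_eq girth_cycle_def cycle_def awalk_def four_cycle_def
    by (cases e1; cases e2; cases e3; cases e4) auto
  then show thesis
    using xi unfolding xi_cycle_def p_eq
    by (intro that) (auto simp: out_degree_eq_card_Image in_degree_eq_card_Image out_sum_def min_def)
qed

theorem theorem2:
  fixes D :: "'a pair_pre_digraph"
  assumes "oriented_graph D"
    and "strongly_connected (with_proj D)"
    and "girth D = 4"
    and "card (pverts D) \<ge> 6"
    and "\<not> (\<exists>H \<in> (exceptional_digraphs :: 'a pair_pre_digraph set).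
               digraph_iso (with_proj D) (with_proj H))"
  shows "restricted_arc_connected D \<and>
         arc_connectivity D \<le> restricted_arc_connectivity D \<and>
         restricted_arc_connectivity D \<le> xi D"
proof -
  interpret oriented_graph D by (rule assms(1))
  have D: "pair_digraph D" by unfold_locales
  obtain a b c d where cyc: "four_cycle (parcs D) a b c d"
    and xi: "xi D + 4 \<ge> min (out_sum (parcs D) a b c d) (out_sum ((parcs D)\<inverse>) a b c d)"
    using xi_attained[OF D assms(3)] .
  have "D \<notin> exceptional_digraphs"
    using assms(5) digraph_iso_refl[OF wf_digraph_axioms] by blast
  then have not_exc: "\<lparr>pverts = pverts D, parcs = parcs D\<rparr> \<notin> exceptional_digraphs"
    by (cases D) simp
  have sub: "parcs D \<subseteq> pverts D \<times> pverts D" using wellformed' by auto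
  have "card (pverts D) \<ge> 2" using assms(4) by simp
  note in_out = strongly_connected_in_out_arc[OF D assms(2) this]
  have "no_short_cycles (parcs D)"
    using no_short_cycles_if_girth[OF assms(1)] assms(3) by simp
  from exists_four_cycle_cut[OF this cyc pair_finite_verts sub _ _ not_exc] in_out
  obtain S where S: "four_cycle_cut (parcs D) S"
    "card S + 4 \<le> min (out_sum (parcs D) a b c d) (out_sum ((parcs D)\<inverse>) a b c d)"
    by blast
  have cut: "restricted_arc_cut D S"
    by (rule restricted_arc_cut_if_four_cycle_cut[OF D S(1)])
  let ?cards = "card ` {S. restricted_arc_cut D S}"
  \<comment> \<open>The minimum is attained by a restricted arc-cut, to which the bound on
    \<open>arc_connectivity\<close> applies.\<close>
  have "restricted_arc_connectivity D \<in> ?cards"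
    unfolding restricted_arc_connectivity_def using cut by (auto intro: wellorder_InfI)
  then have "arc_connectivity D \<le> restricted_arc_connectivity D"
    using arc_connectivity_le_restricted_arc_cut[OF D] by auto
  moreover have "restricted_arc_connectivity D \<le> card S"
    unfolding restricted_arc_connectivity_def using cut by (auto intro: wellorder_Inf_le1)
  moreover have "card S \<le> xi D" using S(2) xi by linarith
  ultimately show ?thesis
    using cut unfolding restricted_arc_connected_def by auto
qed

end
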